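(* For any set $A\subseteq\{0,1\}^+$ that is in $\mathbf{FPT}$ with a parameterization $\eta\subseteq\{0,1\}^+\times\Omega$, there exist a function $f$, a polynomial $p$ and a constant $d$ (independent of $x$) such that for all $x\in\{0,1\}^+$, $$\mathrm{ic}^{f(\mu_\eta(x))\cdot p}(x:A)\le\mu_\eta(x)+d.$$
   Context: A Turing machine $\Phi$ is a partial decision procedure for $A$ if $\Phi(x)=1\Rightarrow x\in A$ and $\Phi(x)=0\Rightarrow x\notin A$; $\mathrm{dom}(\Phi)=\{x:\Phi(x)\in\{0,1\}\}$. For a time bound $t$, a $t$-approximation for $A$ is a partial decision procedure for $A$ running in time $t$ (here the time bound $f(\mu_\eta(x))\cdot p$ means $n\mapsto f(\mu_\eta(x))\cdot p(n)$); an $O(n^c)$-approximation is one running in time $O(n^c)$. The time-$t$ bounded instance complexity is $\mathrm{ic}^t(x:A)=\min\{|\Phi|:\Phi$ is a $t$-approximation for $A$ and $x\in\mathrm{dom}(\Phi)\}$, $|\Phi|$ the description length. A parameter space is a nonempty set $\Omega$ with a reflexive, transitive, directed relation and an injective encoding into $\{0,1\}^+$; $|k|$ is the encoding length. A parameterization over $\Omega$ is $\eta\subseteq\{0,1\}^+\times\Omega$ such that for every $x$, $\{k:(x,k)\in\eta\}$ is nonempty and upward closed; $\eta_k=\{x:(x,k)\in\eta\}$; $\mu_\eta(x)=\min\{|k|:(x,k)\in\eta\}$. $(A,\eta)\in\mathbf{FPT}$ if there are a constant $c$, a Turing machine $\Psi$ with two inputs and a computable function $g$ such that for every $k$, $\Psi(k,\cdot)$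 is an $O(n^c)$-approximation for $A$ with domain $\eta_k$ and running time at most $g(k)\cdot n^c$. *)

theory Defs
  imports
    "HOL-Library.Extended_Nat"
    "HOL-Computational_Algebra.Polynomial"
begin

type_synonym word = "bool list"

definition words :: "word set" where
  "words = {w. w \<noteq> []}"


subsection \<open>Turing machines\<close>

text \<open>
  Deterministic multitape machines with finite instruction tables. States and tape symbols are
  natural numbers; \<open>0\<close> is the start state and the blank, and the bits 0 and 1 are written as the
  symbols \<open>1\<close> and \<open>2\<close>. An instruction \<open>((q, rs), (q', ws, ms))\<close> applies in state \<open>q\<close> when the heads
  scan \<open>rs\<close>; the first applicable instruction of the table is used, and the machine halts when none
  applies.
\<close>

datatype move = MoveL | Stay | MoveR

type_synonym instr = "(nat \<times> nat list) \<times> (nat \<times> nat list \<times> move list)"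

datatype tm = TM (tapes: nat) ("table": "instr list")

text \<open>
  Two tapes are required so that there is room for a second input; a machine may ignore its second
  tape.
\<close>

definition turing_machine :: "tm \<Rightarrow> bool" where
  "turing_machine M \<longleftrightarrow> tapes M \<ge> 2 \<and>
     (\<forall>((q, rs), (q', ws, ms)) \<in> set (table M).
        length rs = tapes M \<and> length ws = tapes M \<and> length ms = tapes M)"

text \<open>A two-way infinite tape, with cells numbered relative to the head, which is at cell \<open>0\<close>.\<close>

type_synonym tape = "int \<Rightarrow> nat"

type_synonym config = "nat \<times> tape list"

definition symbol :: "bool \<Rightarrow> nat" where
  "symbol b = (if b then 2 else 1)"

definition tape_of :: "word \<Rightarrow> tape" where
  "tape_of w = (\<lambda>i. if 0 \<le> i \<and> i < int (length w) then symbol (w ! nat i) else 0)"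

fun move_head :: "move \<Rightarrow> tape \<Rightarrow> tape" where
  "move_head MoveL t = (\<lambda>i. t (i - 1))"
| "move_head Stay t = t"
| "move_head MoveR t = (\<lambda>i. t (i + 1))"

definition initial :: "tm \<Rightarrow> word list \<Rightarrow> config" where
  "initial M ins = (0, map tape_of ins @ replicate (tapes M - length ins) (\<lambda>_. 0))"

definition step :: "tm \<Rightarrow> config \<Rightarrow> config option" where
  "step M = (\<lambda>(q, ts).
     case map_of (table M) (q, map (\<lambda>t. t 0) ts) of
       None \<Rightarrow> None
     | Some (q', ws, ms) \<Rightarrow> Some (q', map2 (\<lambda>(w, m) t. move_head m (t(0 := w))) (zip ws ms) ts))"

primrec config_after :: "tm \<Rightarrow> config \<Rightarrow> nat \<Rightarrow> config" where
  "config_after M c 0 = c"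
| "config_after M c (Suc n) =
     (case step M (config_after M c n) of None \<Rightarrow> config_after M c n | Some c' \<Rightarrow> c')"

definition halts_within :: "tm \<Rightarrow> word list \<Rightarrow> nat \<Rightarrow> bool" where
  "halts_within M ins n \<longleftrightarrow> step M (config_after M (initial M ins) n) = None"

text \<open>The output is the block of bits on the first tape that starts at the head.\<close>

definition out_word :: "config \<Rightarrow> word" where
  "out_word c = (let t = hd (snd c) in
     map (\<lambda>i. t (int i) = symbol True)
       [0..<(LEAST n. t (int n) \<noteq> symbol False \<and> t (int n) \<noteq> symbol True)])"

definition yields :: "tm \<Rightarrow> word list \<Rightarrow> word \<Rightarrow> bool" where
  "yields M ins v \<longleftrightarrow>
     (\<exists>n. halts_within M ins n \<and> out_word (config_after M (initial M ins) n) = v)"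


subsection \<open>Approximations\<close>

text \<open>
  These notions concern the one-input procedure \<open>x \<mapsto> M(x, par)\<close>, where \<open>x\<close> is written on the first
  tape and the list \<open>par\<close> of fixed further inputs on the following ones. A one-input machine is the
  case \<open>par = []\<close>; for a two-input machine \<open>\<Psi>\<close> the procedure \<open>\<Psi>(k, \<cdot>)\<close> is the case where \<open>par\<close>
  consists of the encoding of \<open>k\<close>.
  The values 1 and 0 are the one-letter outputs; any other output stands for ``undecided''.
\<close>

definition partial_decision_procedure :: "tm \<Rightarrow> word list \<Rightarrow> word set \<Rightarrow> bool" where
  "partial_decision_procedure M par A \<longleftrightarrow>
     (\<forall>x\<in>words. (yields M (x # par) [True] \<longrightarrow> x \<in> A) \<and> (yields M (x # par) [False] \<longrightarrow> x \<notin> A))"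

definition domain :: "tm \<Rightarrow> word list \<Rightarrow> word set" where
  "domain M par = {x \<in> words. yields M (x # par) [False] \<or> yields M (x # par) [True]}"

definition runs_in_time :: "tm \<Rightarrow> word list \<Rightarrow> (nat \<Rightarrow> nat) \<Rightarrow> bool" where
  "runs_in_time M par t \<longleftrightarrow> (\<forall>x\<in>words. halts_within M (x # par) (t (length x)))"

definition approximation :: "(nat \<Rightarrow> nat) \<Rightarrow> tm \<Rightarrow> word list \<Rightarrow> word set \<Rightarrow> bool" where
  "approximation t M par A \<longleftrightarrow> partial_decision_procedure M par A \<and> runs_in_time M par t"


subsection \<open>Description length\<close>

text \<open>
  Descriptions are those of the usual additively optimal reference machine: the string
  \<open>\<langle>M\<rangle>y\<close>, with \<open>\<langle>M\<rangle>\<close> a self-delimiting code of the table of \<open>M\<close>, describes the machine that first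
  writes \<open>y\<close> on its second tape and then behaves like \<open>M\<close>. The loading phase takes \<open>|y|\<close>
  steps of that machine: it writes \<open>y\<close> from right to left, in states \<open>0, \<dots>, |y| - 1\<close>, and the
  states of \<open>M\<close> are renumbered accordingly. The symbol \<open>a\<close> ranges over what the head of the first
  tape may scan meanwhile.
\<close>

definition loader :: "word \<Rightarrow> nat \<Rightarrow> instr list" where
  "loader y r = [((i, a # replicate (r - 1) 0),
                  (Suc i,
                   a # symbol (rev y ! i) # replicate (r - 2) 0,
                   Stay # (if Suc i < length y then MoveL else Stay) # replicate (r - 2) Stay)).
                 i \<leftarrow> [0..<length y], a \<leftarrow> [0, symbol False, symbol True]]"

definition hardwire :: "word \<Rightarrow> tm \<Rightarrow> tm" where
  "hardwire y M = TM (tapes M)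
     (loader y (tapes M) @
      map (\<lambda>((q, rs), (q', ws, ms)). ((q + length y, rs), (q' + length y, ws, ms))) (table M))"

definition code_nat :: "nat \<Rightarrow> word" where
  "code_nat n = replicate n True @ [False]"

definition code_list :: "('a \<Rightarrow> word) \<Rightarrow> 'a list \<Rightarrow> word" where
  "code_list c xs = code_nat (length xs) @ concat (map c xs)"

fun code_move :: "move \<Rightarrow> word" where
  "code_move MoveL = code_nat 0"
| "code_move Stay = code_nat 1"
| "code_move MoveR = code_nat 2"

fun code_instr :: "instr \<Rightarrow> word" where
  "code_instr ((q, rs), (q', ws, ms)) =
     code_nat q @ code_list code_nat rs @
     code_nat q' @ code_list code_nat ws @ code_list code_move ms"

definition code_tm :: "tm \<Rightarrow> word" where
  "code_tm M = code_nat (tapes M) @ code_list code_instr (table M)"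

definition describes :: "word \<Rightarrow> tm \<Rightarrow> bool" where
  "describes w \<Phi> \<longleftrightarrow> (\<exists>M y. turing_machine M \<and> w = code_tm M @ y \<and> \<Phi> = hardwire y M)"

definition description_length :: "tm \<Rightarrow> nat" where
  "description_length \<Phi> = (LEAST n. \<exists>w. describes w \<Phi> \<and> length w = n)"

lemma code_nat_append_eq: "code_nat m @ u = code_nat n @ v \<Longrightarrow> m = n \<and> u = v"
proof (induction m arbitrary: n)
  case 0
  then show ?case by (cases n) (auto simp: code_nat_def)
next
  case (Suc m)
  then show ?case by (cases n) (auto simp: code_nat_def)
qed

lemma code_list_append_eq:
  assumes c: "\<And>x y u v. c x @ u = c y @ v \<Longrightarrow> x = y \<and> u = v"
    and eq: "code_list c xs @ u = code_list c ys @ v"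
  shows "xs = ys \<and> u = v"
proof -
  have "length xs = length ys" "concat (map c xs) @ u = concat (map c ys) @ v"
    using eq by (auto simp: code_list_def dest!: code_nat_append_eq)
  then show ?thesis
  proof (induction xs ys rule: list_induct2)
    case (Cons x xs y ys)
    then show ?case using c[of x "concat (map c xs) @ u" y "concat (map c ys) @ v"] by auto
  qed simp
qed

lemma code_move_append_eq: "code_move m @ u = code_move n @ v \<Longrightarrow> m = n \<and> u = v"
  by (cases m; cases n) (auto dest: code_nat_append_eq)

lemma code_instr_append_eq:
  assumes "code_instr i @ u = code_instr j @ v"
  shows "i = j \<and> u = v"
proof -
  obtain q rs q' ws ms where i: "i = ((q, rs), (q', ws, ms))" by (metis surj_pair)
  obtain p rs' p' ws' ms' where j: "j = ((p, rs'), (p', ws', ms'))" by (metis surj_pair)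
  have list_nat: "xs = ys \<and> u' = v'"
    if "code_list code_nat xs @ u' = code_list code_nat ys @ v'" for xs ys u' v'
    using code_list_append_eq[OF code_nat_append_eq that] .
  have list_move: "xs = ys \<and> u' = v'"
    if "code_list code_move xs @ u' = code_list code_move ys @ v'" for xs ys u' v'
    using code_list_append_eq[OF code_move_append_eq that] .
  from assms show ?thesis
    unfolding i j code_instr.simps append_assoc
    by (metis code_nat_append_eq list_nat list_move)
qed

text \<open>A description determines the machine it describes, and every machine has a description.\<close>

lemma code_tm_append_eq:
  assumes "code_tm M @ y = code_tm M' @ y'"
  shows "M = M' \<and> y = y'"
proof -
  have "tapes M = tapes M' \<and>
      code_list code_instr (table M) @ y = code_list code_instr (table M') @ y'"
    using assms unfolding code_tm_def append_assoc by (rule code_nat_append_eq)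
  then show ?thesis
    using code_list_append_eq[OF code_instr_append_eq] tm.expand by blast
qed

lemma describes_unique: "describes w \<Phi> \<Longrightarrow> describes w \<Psi> \<Longrightarrow> \<Phi> = \<Psi>"
  unfolding describes_def using code_tm_append_eq by blast

lemma describes_code_tm:
  assumes "turing_machine M"
  shows "describes (code_tm M) M"
proof -
  have "hardwire [] M = M"
    by (cases M) (simp add: hardwire_def loader_def case_prod_unfold)
  then show ?thesis
    unfolding describes_def using assms by (metis append_Nil2)
qed


subsection \<open>Instance complexity\<close>

text \<open>The value is \<open>\<infinity>\<close> if there is no suitable machine.\<close>

definition ic :: "(nat \<Rightarrow> nat) \<Rightarrow> word \<Rightarrow> word set \<Rightarrow> enat" where
  "ic t x A = (INF \<Phi> \<in> {\<Phi>. turing_machine \<Phi> \<and> approximation t \<Phi> [] A \<and> x \<in> domain \<Phi> []}.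
     enat (description_length \<Phi>))"


subsection \<open>Parameterizations\<close>

definition parameter_space :: "'k set \<Rightarrow> ('k \<Rightarrow> 'k \<Rightarrow> bool) \<Rightarrow> ('k \<Rightarrow> word) \<Rightarrow> bool" where
  "parameter_space \<Omega> le enc \<longleftrightarrow>
     \<Omega> \<noteq> {} \<and> reflp_on \<Omega> le \<and> transp_on \<Omega> le \<and>
     (\<forall>a\<in>\<Omega>. \<forall>b\<in>\<Omega>. \<exists>c\<in>\<Omega>. le a c \<and> le b c) \<and>
     inj_on enc \<Omega> \<and> enc ` \<Omega> \<subseteq> words"

definition parameterization :: "'k set \<Rightarrow> ('k \<Rightarrow> 'k \<Rightarrow> bool) \<Rightarrow> (word \<times> 'k) set \<Rightarrow> bool" where
  "parameterization \<Omega> le \<eta> \<longleftrightarrow>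
     \<eta> \<subseteq> words \<times> \<Omega> \<and>
     (\<forall>x\<in>words. (\<exists>k. (x, k) \<in> \<eta>) \<and> (\<forall>k. \<forall>k'\<in>\<Omega>. (x, k) \<in> \<eta> \<longrightarrow> le k k' \<longrightarrow> (x, k') \<in> \<eta>))"

definition slice :: "(word \<times> 'k) set \<Rightarrow> 'k \<Rightarrow> word set" where
  "slice \<eta> k = {x. (x, k) \<in> \<eta>}"

definition mu :: "('k \<Rightarrow> word) \<Rightarrow> (word \<times> 'k) set \<Rightarrow> word \<Rightarrow> nat" where
  "mu enc \<eta> x = (LEAST n. \<exists>k. (x, k) \<in> \<eta> \<and> length (enc k) = n)"

text \<open>Values are output in binary, least significant bit first.\<close>

definition computable :: "'k set \<Rightarrow> ('k \<Rightarrow> word) \<Rightarrow> ('k \<Rightarrow> nat) \<Rightarrow> bool" where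
  "computable \<Omega> enc g \<longleftrightarrow>
     (\<exists>M. turing_machine M \<and> (\<forall>k\<in>\<Omega>. \<exists>v. yields M [enc k] v \<and> horner_sum of_bool 2 v = g k))"

text \<open>
  For each fixed \<open>k\<close>, running in time \<open>g k * n ^ c\<close> makes \<open>\<Psi>(k, \<cdot>)\<close> an \<open>O(n ^ c)\<close>-approximation.
\<close>

definition FPT :: "'k set \<Rightarrow> ('k \<Rightarrow> word) \<Rightarrow> (word set \<times> (word \<times> 'k) set) set" where
  "FPT \<Omega> enc = {(A, \<eta>). \<exists>(c::nat) \<Psi> g. turing_machine \<Psi> \<and> computable \<Omega> enc g \<and>
     (\<forall>k\<in>\<Omega>. approximation (\<lambda>n. g k * n ^ c) \<Psi> [enc k] A \<and> domain \<Psi> [enc k] = slice \<eta> k)}"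

end

theory Submission
  imports Defs
begin

text \<open>
  If \<open>\<Psi>\<close> witnesses membership in FPT and \<open>k\<close> is a shortest parameter with \<open>(x, k) \<in> \<eta>\<close>,
  then \<open>\<Psi>\<close> with \<open>k\<close> hardwired is a one-input approximation that decides \<open>x\<close>. Its description
  consists of the fixed code of \<open>\<Psi>\<close> followed by the encoding of \<open>k\<close>, of length \<open>\<mu>(x)\<close>. Its
  running time exceeds that of \<open>\<Psi>(k, \<cdot>)\<close> by the \<open>|k|\<close> steps of the loading phase. As only finitely
  many parameters have an encoding of a given length, the factor \<open>g(k)\<close> is bounded in terms of \<open>|k|\<close>.
\<close>

lemma config_after_add:
  "config_after M c (m + n) = config_after M (config_after M c m) n"
  by (induction n) (auto split: option.splits)

lemma config_after_halted:
  assumes "step M c = None"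
  shows "config_after M c n = c"
  by (induction n) (use assms in auto)

text \<open>Once no instruction applies, \<open>config_after\<close> repeats the halted
  configuration forever.\<close>

lemma halts_within_mono:
  assumes "halts_within M ins m" "m \<le> n"
  shows "halts_within M ins n"
proof -
  have "config_after M (initial M ins) n = config_after M (initial M ins) m"
    using assms config_after_add[of M "initial M ins" m "n - m"]
    by (simp add: halts_within_def config_after_halted)
  then show ?thesis using assms by (simp add: halts_within_def)
qed

lemma set_loader:
  "set (loader y r) =
     (\<Union>i<length y. \<Union>a\<in>{0, symbol False, symbol True}.
        {((i, a # replicate (r - 1) 0),
          (Suc i,
           a # symbol (rev y ! i) # replicate (r - 2) 0,
           Stay # (if Suc i < length y then MoveL else Stay) # replicate (r - 2) Stay))})"
  unfolding loader_def by (auto simp: lessThan_atLeast0)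

lemma turing_machine_hardwire:
  assumes "turing_machine M"
  shows "turing_machine (hardwire y M)"
  using assms unfolding turing_machine_def hardwire_def by (fastforce simp: set_loader)

text \<open>The state and the symbol scanned on the first tape determine the entry, so the lookup
  cannot return a different one.\<close>

lemma map_of_loader:
  assumes "i < length y" "a \<in> {0, symbol False, symbol True}"
  shows "map_of (loader y r) (i, a # replicate (r - 1) 0) =
    Some (Suc i,
      a # symbol (rev y ! i) # replicate (r - 2) 0,
      Stay # (if Suc i < length y then MoveL else Stay) # replicate (r - 2) Stay)"
proof -
  let ?key = "(i, a # replicate (r - 1) 0)"
  have "?key \<in> fst ` set (loader y r)"
    using assms by (force simp: set_loader)
  then obtain v where v: "map_of (loader y r) ?key = Some v"
    by (metis map_of_eq_None_iff not_None_eq)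
  from map_of_SomeD[OF v] show ?thesis
    unfolding v by (auto simp: set_loader)
qed

lemma map_of_loader_None: "map_of (loader y r) (q + length y, rs) = None"
  by (auto simp: map_of_eq_None_iff set_loader)

lemma map_of_shift_states:
  fixes I :: "instr list"
  shows "map_of (map (\<lambda>((q, rs), (q', ws, ms)). ((q + n, rs), (q' + n, ws, ms))) I) (q + n, rs) =
    map_option (\<lambda>(q', ws, ms). (q' + n, ws, ms)) (map_of I (q, rs))"
  by (induction I) auto

definition shift_state :: "nat \<Rightarrow> config \<Rightarrow> config" where
  "shift_state n c = (fst c + n, snd c)"

text \<open>From state \<open>length y\<close> on no loader entry matches, so the lookup falls
  through to the renumbered table of \<open>M\<close>. Halting carries over as well, since
  \<open>None\<close> corresponds to \<open>None\<close>.\<close>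

lemma step_hardwire_shift:
  "step (hardwire y M) (shift_state (length y) c) =
     map_option (shift_state (length y)) (step M c)"
  by (cases c)
    (auto simp: step_def hardwire_def shift_state_def map_add_def map_of_loader_None
      map_of_shift_states split: option.splits)

lemma config_after_hardwire_shift:
  "config_after (hardwire y M) (shift_state (length y) c) n =
     shift_state (length y) (config_after M c n)"
  by (induction n) (auto simp: step_hardwire_shift split: option.splits)

text \<open>After \<open>i\<close> steps the second tape holds the last \<open>i\<close> letters of
  \<open>y\<close>. While letters remain to be written, its head is on the blank cell just left of
  them, hence \<open>j - 1\<close>; after the last write it stays on the first letter.\<close>

definition loading :: "tm \<Rightarrow> word \<Rightarrow> word \<Rightarrow> nat \<Rightarrow> config" where
  "loading M x y i =
     (i, tape_of x #
         (\<lambda>j. tape_of (drop (length y - i) y) (if i < length y then j - 1 else j)) #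
         replicate (tapes M - 2) (\<lambda>_. 0))"

lemma tape_of_scan: "tape_of x i \<in> {0, symbol False, symbol True}"
  by (auto simp: tape_of_def symbol_def)

lemma tape_of_Cons: "(\<lambda>j. tape_of w (j - 1))(0 := symbol b) = tape_of (b # w)"
  by (rule ext) (auto simp: tape_of_def nth_Cons' nat_diff_distrib)

lemma step_loading:
  assumes "tapes M \<ge> 2" "i < length y"
  shows "step (hardwire y M) (loading M x y i) = Some (loading M x y (Suc i))"
proof -
  have r: "replicate (tapes M - Suc 0) (0::nat) = 0 # replicate (tapes M - 2) 0"
    using assms by (metis Suc_diff_Suc diff_Suc_1' numeral_2_eq_2 Suc_le_lessD replicate_Suc)
  \<comment> \<open>Writing goes from right to left, so step \<open>i\<close> puts one more letter
    in front of the suffix.\<close>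
  have dr: "drop (length y - Suc i) y = (rev y ! i) # drop (length y - i) y"
    using assms by (simp add: rev_nth Cons_nth_drop_Suc[symmetric] Suc_diff_Suc)
  \<comment> \<open>As \<open>i < length y\<close>, the second head reads cell \<open>-1\<close> of
    the suffix, which is blank.\<close>
  have scan: "map (\<lambda>t. t 0) (snd (loading M x y i)) = tape_of x 0 # replicate (tapes M - 1) 0"
    using assms by (simp add: loading_def tape_of_def[of "drop _ _"] r)
  have "map_of (table (hardwire y M)) (i, tape_of x 0 # replicate (tapes M - 1) 0) =
    Some (Suc i,
      tape_of x 0 # symbol (rev y ! i) # replicate (tapes M - 2) 0,
      Stay # (if Suc i < length y then MoveL else Stay) # replicate (tapes M - 2) Stay)"
    using map_of_loader[OF assms(2) tape_of_scan]
    by (simp add: hardwire_def map_add_def map_of_append split: option.splits)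
  then have "step (hardwire y M) (loading M x y i) =
    Some (Suc i, map2 (\<lambda>(w, m) t. move_head m (t(0 := w)))
      (zip (tape_of x 0 # symbol (rev y ! i) # replicate (tapes M - 2) 0)
        (Stay # (if Suc i < length y then MoveL else Stay) # replicate (tapes M - 2) Stay))
      (snd (loading M x y i)))"
    using scan by (simp add: step_def loading_def)
  \<comment> \<open>The first tape and the spare tapes get back the symbol they scan. On the second
    tape the last step omits the left move, which matches the case distinction in
    \<open>loading\<close>.\<close>
  also have "\<dots> = Some (loading M x y (Suc i))"
    using assms(2) by (auto simp: loading_def dr zip_replicate tape_of_Cons fun_upd_idem)
  finally show ?thesis .
qed

lemma config_after_loading:
  assumes "turing_machine M" "y \<noteq> []" "i \<le> length y"
  shows "config_after (hardwire y M) (initial (hardwire y M) [x]) i = loading M x y i"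
  using assms(3)
proof (induction i)
  case 0
  have "replicate (tapes M - Suc 0) (\<lambda>_::int. 0::nat) = (\<lambda>_. 0) # replicate (tapes M - 2) (\<lambda>_. 0)"
    using assms(1) unfolding turing_machine_def
    by (metis Suc_diff_Suc diff_Suc_1' numeral_2_eq_2 Suc_le_lessD replicate_Suc)
  then show ?case
    using assms(2) by (auto simp: initial_def loading_def hardwire_def tape_of_def[of "[]"])
next
  case (Suc i)
  then show ?case
    using assms(1) by (simp add: step_loading turing_machine_def)
qed

lemma config_after_hardwire:
  assumes "turing_machine M" "y \<noteq> []"
  shows "config_after (hardwire y M) (initial (hardwire y M) [x]) (length y + n) =
    shift_state (length y) (config_after M (initial M [x, y]) n)"
proof -
  \<comment> \<open>Loading ends in the renumbered start state, with both heads at the start of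
    their inputs.\<close>
  have "loading M x y (length y) = shift_state (length y) (initial M [x, y])"
    by (simp add: loading_def shift_state_def initial_def numeral_2_eq_2)
  then show ?thesis
    using assms by (simp add: config_after_add config_after_loading config_after_hardwire_shift)
qed

lemma halts_within_hardwire:
  assumes "turing_machine M" "y \<noteq> []"
  shows "halts_within (hardwire y M) [x] (length y + n) \<longleftrightarrow> halts_within M [x, y] n"
  using assms by (simp add: halts_within_def config_after_hardwire step_hardwire_shift)

text \<open>A loader instruction applies throughout the loading phase. This excludes the halting
  times below \<open>length y\<close>, which \<open>halts_within_hardwire\<close> does not
  cover.\<close>

lemma not_halts_within_loading:
  assumes "turing_machine M" "i < length y"
  shows "\<not> halts_within (hardwire y M) [x] i"
proof -
  have "y \<noteq> []" using assms(2) by auto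
  then show ?thesis
    using assms by (simp add: halts_within_def config_after_loading step_loading turing_machine_def)
qed

lemma yields_hardwire:
  assumes "turing_machine M" "y \<noteq> []"
  shows "yields (hardwire y M) [x] v \<longleftrightarrow> yields M [x, y] v"
proof -
  \<comment> \<open>The output is read off the tapes alone, which renumbering leaves
    unchanged.\<close>
  have out: "out_word (shift_state n c) = out_word c" for n c
    by (simp add: out_word_def shift_state_def)
  have "yields (hardwire y M) [x] v \<longleftrightarrow>
    (\<exists>n. halts_within (hardwire y M) [x] (length y + n) \<and>
      out_word (config_after (hardwire y M) (initial (hardwire y M) [x]) (length y + n)) = v)"
    unfolding yields_def
    by (metis assms(1) le_add_diff_inverse not_halts_within_loading not_le)
  then show ?thesis
    using assms by (simp add: yields_def halts_within_hardwire config_after_hardwire out)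
qed

lemma domain_hardwire:
  assumes "turing_machine M" "y \<noteq> []"
  shows "domain (hardwire y M) [] = domain M [y]"
  using assms by (simp add: domain_def yields_hardwire)

lemma approximation_hardwire:
  assumes "turing_machine M" "y \<noteq> []" "approximation t M [y] A"
    and "\<And>n. length y + t n \<le> t' n"
  shows "approximation t' (hardwire y M) [] A"
  using assms halts_within_mono[OF _ assms(4)]
  by (simp add: approximation_def partial_decision_procedure_def runs_in_time_def
      yields_hardwire halts_within_hardwire)

text \<open>The word \<open>y\<close> is appended to the code verbatim, so each of its letters costs
  one letter and the overhead depends on \<open>M\<close> only.\<close>

lemma description_length_hardwire:
  assumes "turing_machine M"
  shows "description_length (hardwire y M) \<le> length (code_tm M) + length y"
proof -
  have "describes (code_tm M @ y) (hardwire y M)"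
    using assms by (auto simp: describes_def)
  then show ?thesis
    unfolding description_length_def by (intro Least_le exI[of _ "code_tm M @ y"]) simp
qed

lemma ic_le_hardwire:
  assumes "turing_machine M" "y \<noteq> []" "approximation t M [y] A" "x \<in> domain M [y]"
    and "\<And>n. length y + t n \<le> t' n"
  shows "ic t' x A \<le> enat (length y + length (code_tm M))"
proof -
  have "ic t' x A \<le> enat (description_length (hardwire y M))"
    unfolding ic_def using assms
    by (intro INF_lower) (auto simp: turing_machine_hardwire domain_hardwire
        intro: approximation_hardwire)
  also have "\<dots> \<le> enat (length y + length (code_tm M))"
    using description_length_hardwire[OF assms(1), of y] by (simp add: add.commute)
  finally show ?thesis .
qed

lemma mu_attained:
  assumes "parameterization \<Omega> le \<eta>" "x \<in> words"
  obtains k where "k \<in> \<Omega>" "(x, k) \<in> \<eta>" "length (enc k) = mu enc \<eta> x"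
proof -
  have "\<exists>n k. (x, k) \<in> \<eta> \<and> length (enc k) = n"
    using assms by (auto simp: parameterization_def)
  from LeastI_ex[OF this] obtain k where "(x, k) \<in> \<eta>" "length (enc k) = mu enc \<eta> x"
    unfolding mu_def by blast
  with that show thesis
    using assms(1) by (auto simp: parameterization_def)
qed

text \<open>\<open>enc\<close> is injective, and only finitely many words have length
  \<open>m\<close>.\<close>

lemma finite_parameters_of_length:
  assumes "parameter_space \<Omega> le enc"
  shows "finite {k \<in> \<Omega>. length (enc k) = m}"
proof (rule finite_imageD)
  show "finite (enc ` {k \<in> \<Omega>. length (enc k) = m})"
    by (rule finite_subset[OF _ finite_lists_length_eq[of UNIV m]]) auto
  show "inj_on enc {k \<in> \<Omega>. length (enc k) = m}"
    using assms by (auto simp: parameter_space_def intro: inj_on_subset)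
qed

theorem theorem17:
  fixes A :: "word set"
    and \<Omega> :: "'k set"
    and le :: "'k \<Rightarrow> 'k \<Rightarrow> bool"
    and enc :: "'k \<Rightarrow> word"
    and \<eta> :: "(word \<times> 'k) set"
  assumes "A \<subseteq> words"
    and "parameter_space \<Omega> le enc"
    and "parameterization \<Omega> le \<eta>"
    and "(A, \<eta>) \<in> FPT \<Omega> enc"
  shows "\<exists>(f :: nat \<Rightarrow> nat) (p :: nat poly) (d :: nat). \<forall>x\<in>words.
           ic (\<lambda>n. f (mu enc \<eta> x) * poly p n) x A \<le> enat (mu enc \<eta> x + d)"
proof -
  obtain c \<Psi> g where \<Psi>: "turing_machine \<Psi>"
    and approx: "\<And>k. k \<in> \<Omega> \<Longrightarrow> approximation (\<lambda>n. g k * n ^ c) \<Psi> [enc k] A"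
    and dom: "\<And>k. k \<in> \<Omega> \<Longrightarrow> domain \<Psi> [enc k] = slice \<eta> k"
    using assms(4) unfolding FPT_def by blast
  \<comment> \<open>The factor may depend on \<open>k\<close> only through its length:
    \<open>m\<close> pays for loading, and the sum dominates \<open>g k\<close> for every
    \<open>k\<close> of that length.\<close>
  define f where "f m = m + (\<Sum>k | k \<in> \<Omega> \<and> length (enc k) = m. g k)" for m
  \<comment> \<open>The constant term covers the loading cost even where
    \<open>n ^ c = 0\<close>.\<close>
  define p :: "nat poly" where "p = 1 + monom 1 c"
  have "ic (\<lambda>n. f (mu enc \<eta> x) * poly p n) x A \<le> enat (mu enc \<eta> x + length (code_tm \<Psi>))"
    if x: "x \<in> words" for x
  proof -
    obtain k where k: "k \<in> \<Omega>" "(x, k) \<in> \<eta>" "length (enc k) = mu enc \<eta> x"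
      using mu_attained[OF assms(3) x] .
    have "enc k \<noteq> []"
      using assms(2) k(1) by (auto simp: parameter_space_def words_def)
    moreover have "x \<in> domain \<Psi> [enc k]"
      using k by (simp add: dom slice_def)
    moreover have "length (enc k) + g k * n ^ c \<le> f (mu enc \<eta> x) * poly p n" for n
    proof -
      \<comment> \<open>Finiteness matters here: a sum over an infinite set would be 0 by
        default.\<close>
      have "g k \<le> (\<Sum>k | k \<in> \<Omega> \<and> length (enc k) = mu enc \<eta> x. g k)"
        using k finite_parameters_of_length[OF assms(2)] by (intro member_le_sum) auto
      then have "length (enc k) + g k \<le> f (mu enc \<eta> x)"
        using k(3) by (simp add: f_def)
      then have "length (enc k) * 1 + g k * n ^ c \<le> f (mu enc \<eta> x) * 1 + f (mu enc \<eta> x) * n ^ c"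
        by (intro add_mono mult_right_mono) auto
      then show ?thesis
        by (simp add: p_def poly_monom algebra_simps)
    qed
    ultimately show ?thesis
      using ic_le_hardwire[OF \<Psi> _ approx[OF k(1)]] k(3) by metis
  qed
  then show ?thesis by blast
qed

end
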